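(* Let $k_0,k_1,\dots,k_m$ be positive real numbers, let $q\in(0,1)$, and let $\Sigma=\{\sum_{i=0}^m\varepsilon_ik_i:\varepsilon_i\in\{0,1\}\}$. Assume that $E(k_0,k_1,\dots,k_m;q)$ has non-empty interior in $\mathbb{R}$. If $U(\Sigma)\neq\Sigma$, then the set of uniqueness $U(k_0,k_1,\dots,k_m;q)$ is nowhere dense in $\mathbb{R}$.
   Context: The multigeometric sequence $(k_0,\dots,k_m;q)$ is $(k_0,\dots,k_m,k_0q,\dots,k_mq,k_0q^2,\dots,k_mq^2,\dots)$. For a summable sequence $(x_n)$ of positive reals, $E(x_n)=\{\sum_{n\in A}x_n:A\subset\mathbb{N}\}$ and $U(x_n)$ is the set of $x\in E(x_n)$ for which exactly one $A\subset\mathbb{N}$ satisfies $x=\sum_{n\in A}x_n$; $E(k_0,\dots,k_m;q)$ and $U(k_0,\dots,k_m;q)$ denote these sets for the multigeometric sequence, so that $E(k_0,\dots,k_m;q)=\{\sum_{n=0}^\infty a_nq^n:(a_n)\in\Sigma^{\mathbb{N}_0}\}$, where $\mathbb{N}_0=\{0,1,2,\dots\}$. $U(\Sigma)$ is the set of those $\sigma\in\Sigma$ for which there is exactly one $(\varepsilon_0,\dots,\varepsilon_m)\in\{0,1\}^{m+1}$ with $\sigma=\sum_{i=0}^m\varepsilon_ik_i$. *)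

theory Defs
  imports "HOL-Analysis.Analysis" "HOL-Library.FuncSet"
begin

(* Meant for summable sequences of positive reals, where infsum x A is the sum over A;
   infsum is 0 on a non-summable family. *)
definition subsums :: "(nat \<Rightarrow> real) \<Rightarrow> real set" where
  "subsums x = {s. \<exists>A::nat set. s = infsum x A}"

definition unique_subsums :: "(nat \<Rightarrow> real) \<Rightarrow> real set" where
  "unique_subsums x = {s \<in> subsums x. \<exists>!A::nat set. s = infsum x A}"

(* The values k 0, ..., k m are the parameters; k i is never used for i > m.
   Indexing starts at 0: position n = j * (m + 1) + i with i \<le> m carries k i * q ^ j. *)
definition multigeometric :: "nat \<Rightarrow> (nat \<Rightarrow> real) \<Rightarrow> real \<Rightarrow> nat \<Rightarrow> real" where
  "multigeometric m k q n = k (n mod (m + 1)) * q ^ (n div (m + 1))"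

(* Tuples in {0,1}^(m+1), as functions on {0..m}. Extensionality (PiE rather than Pi)
   is essential: otherwise "exactly one tuple" below would never hold. *)
definition bit_tuples :: "nat \<Rightarrow> (nat \<Rightarrow> real) set" where
  "bit_tuples m = {0..m} \<rightarrow>\<^sub>E {0, 1}"

definition Sigma_set :: "nat \<Rightarrow> (nat \<Rightarrow> real) \<Rightarrow> real set" where
  "Sigma_set m k = {s. \<exists>\<epsilon> \<in> bit_tuples m. s = (\<Sum>i=0..m. \<epsilon> i * k i)}"

definition unique_Sigma :: "nat \<Rightarrow> (nat \<Rightarrow> real) \<Rightarrow> real set" where
  "unique_Sigma m k =
     {s \<in> Sigma_set m k. \<exists>!\<epsilon>. \<epsilon> \<in> bit_tuples m \<and> s = (\<Sum>i=0..m. \<epsilon> i * k i)}"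

definition nowhere_dense :: "'a::topological_space set \<Rightarrow> bool" where
  "nowhere_dense S \<longleftrightarrow> interior (closure S) = {}"

end

theory Submission
  imports Defs
begin

text \<open>
  Let \<open>E\<close> be the set of subsums and \<open>U\<close> the set of uniqueness. Since \<open>U(\<Sigma>) \<noteq> \<Sigma>\<close>, there are two
  distinct sets \<open>B, C \<subseteq> {0..m}\<close> of indices over which \<open>k\<close> has the same sum \<open>\<sigma>\<close>. Cut an arbitrary
  subsum \<open>x\<close> after its first \<open>n\<close> blocks of length \<open>m + 1\<close>, leaving \<open>p\<close>, and continue with \<open>\<sigma>\<close> in
  the next block and with an arbitrary element \<open>z\<close> of \<open>E\<close> after that. By self-similarity of the
  sequence the result is \<open>p + q\<^sup>n (\<sigma> + q z)\<close>, and it has two representations, one through \<open>B\<close> and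
  one through \<open>C\<close>; so it is never in \<open>U\<close>. When \<open>z\<close> ranges over the interior of \<open>E\<close>, these points
  fill a non-empty open set that is disjoint from \<open>U\<close>, and hence from the closure of \<open>U\<close>. They lie
  within \<open>q\<^sup>n\<close> times the sum of the whole sequence from \<open>x\<close>, so such open sets come arbitrarily
  close to every point of \<open>E\<close>, in particular to every point of \<open>U\<close>.
\<close>

lemma unique_subsums_notI:
  assumes "infsum f A = infsum f B" and "A \<noteq> B"
  shows "infsum f A \<notin> unique_subsums f"
  using assms unfolding unique_subsums_def by blast

lemma multigeometric_nonneg:
  assumes "\<And>i. i \<le> m \<Longrightarrow> k i \<ge> 0" and "0 \<le> q"
  shows "multigeometric m k q n \<ge> 0"
  unfolding multigeometric_def using assms
  by (metis Suc_eq_plus1 less_Suc_eq_le mod_less_divisor mult_nonneg_nonneg zero_le_power zero_less_Suc)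

lemma multigeometric_shift:
  "multigeometric m k q (n * (m + 1) + j) = q ^ n * multigeometric m k q j"
proof -
  have "(n * (m + 1) + j) div (m + 1) = n + j div (m + 1)"
    by (metis Suc_eq_plus1 add.commute div_mult_self1 nat.distinct(1))
  moreover have "(n * (m + 1) + j) mod (m + 1) = j mod (m + 1)"
    by (metis mod_mult_self3)
  ultimately show ?thesis
    unfolding multigeometric_def by (simp add: power_add)
qed

lemma multigeometric_summable_on:
  assumes "\<And>i. i \<le> m \<Longrightarrow> k i \<ge> 0" and "0 \<le> q" and "q < 1"
  shows "multigeometric m k q summable_on A"
proof -
  let ?g = "multigeometric m k q" and ?N = "m + 1"
  have nonneg: "?g n \<ge> 0" for n
    using multigeometric_nonneg assms by blast
  have "summable ?g"
  proof (rule summableI_nonneg_bounded)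
    fix n
    have "sum ?g {..<n} \<le> sum ?g {..<n * ?N}"
      by (rule sum_mono2) (auto simp: nonneg)
    also have "\<dots> = (\<Sum>j<n. sum ?g {j * ?N..<j * ?N + ?N})"
      by (simp only: sum.nat_group)
    also have "\<dots> = (\<Sum>j<n. q ^ j * sum ?g {0..<?N})"
    proof (rule sum.cong)
      fix j
      have "sum ?g {j * ?N..<j * ?N + ?N} = (\<Sum>i = 0..<?N. ?g (j * ?N + i))"
        using sum.shift_bounds_nat_ivl[of ?g 0 "j * ?N" ?N] by (simp add: add.commute)
      then show "sum ?g {j * ?N..<j * ?N + ?N} = q ^ j * sum ?g {0..<?N}"
        by (simp only: multigeometric_shift sum_distrib_left)
    qed simp
    also have "\<dots> = (\<Sum>j<n. q ^ j) * sum ?g {0..<?N}"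
      by (simp only: sum_distrib_right)
    also have "\<dots> \<le> (\<Sum>j. q ^ j) * sum ?g {0..<?N}"
      by (intro mult_right_mono sum_le_suminf summable_geometric sum_nonneg)
         (use assms nonneg in auto)
    finally show "sum ?g {..<n} \<le> (\<Sum>j. q ^ j) * sum ?g {0..<?N}" .
  qed (rule nonneg)
  then have "?g summable_on UNIV"
    by (rule summable_nonneg_imp_summable_on) (simp add: nonneg)
  then show ?thesis
    by (rule summable_on_subset) simp
qed

text \<open>Self-similarity: the index set that starts with \<open>P\<close> inside the first \<open>n\<close> blocks and continues
  with a copy of \<open>D\<close>.\<close>

lemma infsum_multigeometric_append:
  assumes "\<And>i. i \<le> m \<Longrightarrow> k i \<ge> 0" and "0 \<le> q" and "q < 1"
    and P: "P \<subseteq> {..<n * (m + 1)}"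
  shows "infsum (multigeometric m k q) (P \<union> (+) (n * (m + 1)) ` D)
    = infsum (multigeometric m k q) P + q ^ n * infsum (multigeometric m k q) D"
proof -
  let ?g = "multigeometric m k q"
  have "infsum ?g ((+) (n * (m + 1)) ` D) = infsum (\<lambda>j. q ^ n * ?g j) D"
    by (subst infsum_reindex) (auto simp only: inj_on_def o_def multigeometric_shift add_left_cancel)
  also have "\<dots> = q ^ n * infsum ?g D"
    by (rule infsum_cmult_right')
  finally have "infsum ?g ((+) (n * (m + 1)) ` D) = q ^ n * infsum ?g D" .
  moreover have "P \<inter> (+) (n * (m + 1)) ` D = {}"
    using P by fastforce
  ultimately show ?thesis
    using infsum_Un_disjoint multigeometric_summable_on[of m k q] assms(1-3) by metis
qed

lemma append_index_set_inj:
  fixes N :: nat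
  assumes "P \<subseteq> {..<N}" and "P' \<subseteq> {..<N}" and "P \<union> (+) N ` D = P' \<union> (+) N ` D'"
  shows "P = P'" and "D = D'"
proof -
  have prefix: "(Q \<union> (+) N ` F) \<inter> {..<N} = Q" if "Q \<subseteq> {..<N}" for Q F
    using that by auto
  show "P = P'"
    using prefix[OF assms(1)] prefix[OF assms(2)] assms(3) by metis
  have rest: "{j. N + j \<in> Q \<union> (+) N ` F} = F" if "Q \<subseteq> {..<N}" for Q F
    using that by auto
  show "D = D'"
    using rest[OF assms(1)] rest[OF assms(2)] assms(3) by metis
qed

lemma infsum_multigeometric_first_block:
  assumes "B \<subseteq> {0..m}"
  shows "infsum (multigeometric m k q) B = sum k B"
proof -
  have "finite B"
    using assms finite_subset by blast
  moreover have "multigeometric m k q i = k i" if "i \<in> B" for i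
    using assms that by (auto simp: multigeometric_def subset_iff less_Suc_eq_le)
  ultimately show ?thesis
    by simp
qed

lemma bit_tuple_sum:
  assumes "\<epsilon> \<in> bit_tuples m"
  shows "(\<Sum>i=0..m. \<epsilon> i * k i) = sum k {i \<in> {0..m}. \<epsilon> i = 1}"
proof -
  have "\<epsilon> i * k i = (if \<epsilon> i = 1 then k i else 0)" if "i \<in> {0..m}" for i
    using assms that by (auto simp: bit_tuples_def PiE_def Pi_def)
  then have "(\<Sum>i=0..m. \<epsilon> i * k i) = (\<Sum>i=0..m. if \<epsilon> i = 1 then k i else 0)"
    by (intro sum.cong) auto
  then show ?thesis
    by (simp only: sum.inter_filter finite_atLeastAtMost)
qed

lemma bit_tuples_eqI:
  assumes "\<epsilon> \<in> bit_tuples m" and "\<delta> \<in> bit_tuples m"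
    and "{i \<in> {0..m}. \<epsilon> i = 1} = {i \<in> {0..m}. \<delta> i = 1}"
  shows "\<epsilon> = \<delta>"
proof (rule PiE_ext)
  show "\<epsilon> \<in> {0..m} \<rightarrow>\<^sub>E {0, 1}" and "\<delta> \<in> {0..m} \<rightarrow>\<^sub>E {0, 1}"
    using assms(1,2) by (simp_all add: bit_tuples_def)
next
  fix i assume i: "i \<in> {0..m}"
  then have "\<epsilon> i \<in> {0, 1}" and "\<delta> i \<in> {0, 1}"
    using assms(1,2) unfolding bit_tuples_def by (meson PiE_mem)+
  moreover have "\<epsilon> i = 1 \<longleftrightarrow> \<delta> i = 1"
    using assms(3) i by blast
  ultimately show "\<epsilon> i = \<delta> i"
    by auto
qed

lemma unique_Sigma_neq_obtains:
  assumes "unique_Sigma m k \<noteq> Sigma_set m k"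
  obtains B C where "B \<subseteq> {0..m}" and "C \<subseteq> {0..m}" and "B \<noteq> C" and "sum k B = sum k C"
proof -
  obtain \<epsilon> \<delta> where "\<epsilon> \<in> bit_tuples m" "\<delta> \<in> bit_tuples m" "\<epsilon> \<noteq> \<delta>"
    and "(\<Sum>i=0..m. \<epsilon> i * k i) = (\<Sum>i=0..m. \<delta> i * k i)"
    using assms unfolding unique_Sigma_def Sigma_set_def by auto
  then show ?thesis
    using that[of "{i \<in> {0..m}. \<epsilon> i = 1}" "{i \<in> {0..m}. \<delta> i = 1}"]
    by (metis (no_types, lifting) bit_tuple_sum bit_tuples_eqI mem_Collect_eq subsetI)
qed

theorem proposition5p11:
  fixes m :: nat and k :: "nat \<Rightarrow> real" and q :: real
  assumes "\<And>i. i \<le> m \<Longrightarrow> k i > 0"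
    and "0 < q" and "q < 1"
    and "interior (subsums (multigeometric m k q)) \<noteq> {}"
    and "unique_Sigma m k \<noteq> Sigma_set m k"
  shows "nowhere_dense (unique_subsums (multigeometric m k q))"
proof -
  let ?g = "multigeometric m k q" and ?N = "m + 1"
  let ?E = "subsums ?g" and ?U = "unique_subsums ?g"
  define W where "W = interior (closure ?U)"
  define T where "T = infsum ?g UNIV"
  have k0: "\<And>i. i \<le> m \<Longrightarrow> k i \<ge> 0" and q: "0 \<le> q" "q < 1"
    using assms(1-3) by (auto intro: less_imp_le)
  have append: "infsum ?g (P \<union> (+) (n * ?N) ` D) = infsum ?g P + q ^ n * infsum ?g D"
    if "P \<subseteq> {..<n * ?N}" for P D n
    using infsum_multigeometric_append[of m k q] k0 q that by blast
  obtain B C where BC: "B \<subseteq> {0..m}" "C \<subseteq> {0..m}" "B \<noteq> C" "sum k B = sum k C"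
    using unique_Sigma_neq_obtains[OF assms(5)] by blast
  have bounds: "0 \<le> infsum ?g A" "infsum ?g A \<le> T" for A
    unfolding T_def using multigeometric_nonneg[of m k q] multigeometric_summable_on[of m k q] k0 q
    by (auto intro!: infsum_nonneg infsum_mono_neutral)
  \<comment> \<open>Once \<open>\<sigma> = sum k B\<close> fills a whole block, uniqueness is lost.\<close>
  have not_unique: "infsum ?g P + q ^ n * (sum k B + q * z) \<notin> ?U"
    if P: "P \<subseteq> {..<n * ?N}" and z: "z \<in> ?E" for P n z
  proof -
    obtain D where D: "z = infsum ?g D"
      using z by (auto simp: subsums_def)
    have value_of: "infsum ?g (P \<union> (+) (n * ?N) ` (F \<union> (+) (1 * ?N) ` D))
        = infsum ?g P + q ^ n * (sum k F + q * z)" if F: "F \<subseteq> {0..m}" for F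
    proof -
      have "F \<subseteq> {..<1 * ?N}"
        using F by auto
      from append[OF this, of D] append[OF P] show ?thesis
        by (simp only: infsum_multigeometric_first_block[OF F] D power_one_right)
    qed
    have BCN: "B \<subseteq> {..<1 * ?N}" "C \<subseteq> {..<1 * ?N}"
      using BC by auto
    have "P \<union> (+) (n * ?N) ` (B \<union> (+) (1 * ?N) ` D) \<noteq> P \<union> (+) (n * ?N) ` (C \<union> (+) (1 * ?N) ` D)"
      using append_index_set_inj(2)[OF P P] append_index_set_inj(1)[OF BCN] BC(3) by metis
    then show ?thesis
      using unique_subsums_notI value_of[OF BC(1)] value_of[OF BC(2)] BC(4) by metis
  qed
  have "W = {}"
  proof (rule ccontr)
    assume "W \<noteq> {}"
    have "open W" and W_sub: "W \<subseteq> closure ?U"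
      by (auto simp: W_def interior_subset)
    then obtain x where x: "x \<in> W" "x \<in> ?U"
      using \<open>W \<noteq> {}\<close> open_Int_closure_eq_empty[of W ?U] by blast
    obtain A where A: "x = infsum ?g A"
      using x(2) by (auto simp: unique_subsums_def subsums_def)
    obtain e where e: "e > 0" "ball x e \<subseteq> W"
      using \<open>open W\<close> x(1) open_contains_ball by blast
    obtain z where z: "z \<in> interior ?E"
      using assms(4) by blast
    then obtain D where D: "z = infsum ?g D"
      using interior_subset by (force simp: subsums_def)
    have "(\<lambda>n. q ^ n * T) \<longlonglongrightarrow> 0"
      using q by (intro tendsto_mult_left_zero LIMSEQ_realpow_zero)
    from order_tendstoD(2)[OF this e(1)] obtain n where n: "q ^ n * T < e"
      by (auto simp: eventually_sequentially)
    define P where "P = A \<inter> {..<n * ?N}"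
    have P: "P \<subseteq> {..<n * ?N}"
      by (simp add: P_def)
    define f where "f = (\<lambda>z. infsum ?g P + q ^ n * (sum k B + q * z))"
    have f_eq: "f = (\<lambda>y. (infsum ?g P + q ^ n * sum k B) + y) \<circ> (\<lambda>z. (q ^ n * q) *\<^sub>R z)"
      by (auto simp: f_def algebra_simps)
    have "open (f ` interior ?E)"
      unfolding f_eq image_comp[symmetric]
      using assms(2) by (intro open_translation open_scaling) auto
    moreover have "f ` interior ?E \<inter> ?U = {}"
      using not_unique[OF P] interior_subset by (auto simp: f_def)
    ultimately have "f ` interior ?E \<inter> closure ?U = {}"
      using open_Int_closure_eq_empty by blast
    then have "f z \<notin> W"
      using z W_sub by blast
    moreover have "f z \<in> W"
    proof -
      \<comment> \<open>Both \<open>x\<close> and \<open>f z\<close> are \<open>infsum ?g P\<close> plus \<open>q\<^sup>n\<close> times an element of \<open>?E\<close>, a subset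
        of \<open>{0..T}\<close>.\<close>
      define A' where "A' = {j. n * ?N + j \<in> A}"
      have "A = P \<union> (+) (n * ?N) ` A'"
      proof (rule set_eqI)
        fix i show "i \<in> A \<longleftrightarrow> i \<in> P \<union> (+) (n * ?N) ` A'"
          by (cases "i < n * ?N") (auto simp: P_def A'_def image_iff dest: le_Suc_ex simp: not_less)
      qed
      then have x_eq: "x = infsum ?g P + q ^ n * infsum ?g A'"
        using A append[OF P] by metis
      have "B \<subseteq> {..<1 * ?N}"
        using BC by auto
      from append[OF this, of D] have "sum k B + q * z = infsum ?g (B \<union> (+) (1 * ?N) ` D)"
        by (simp only: infsum_multigeometric_first_block[OF BC(1)] D power_one_right)
      then have "0 \<le> sum k B + q * z" "sum k B + q * z \<le> T"
        using bounds by metis+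
      then have "\<bar>infsum ?g A' - (sum k B + q * z)\<bar> \<le> T"
        using bounds[of A'] by linarith
      then have "q ^ n * \<bar>infsum ?g A' - (sum k B + q * z)\<bar> \<le> q ^ n * T"
        using q by (intro mult_left_mono) auto
      moreover have "dist x (f z) = q ^ n * \<bar>infsum ?g A' - (sum k B + q * z)\<bar>"
      proof -
        have "x - f z = q ^ n * (infsum ?g A' - (sum k B + q * z))"
          by (simp add: x_eq f_def algebra_simps)
        then show ?thesis
          using q by (simp only: dist_real_def abs_mult) simp
      qed
      ultimately have "dist x (f z) < e"
        using n by linarith
      then show ?thesis
        using e(2) by (auto simp: subset_iff)
    qed
    ultimately show False
      by blast
  qed
  then show ?thesis
    by (simp add: W_def nowhere_dense_def)
qed

end
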